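(* Let $m,n\ge 0$ be integers with $m+n\ge1$. The diameter of the color graph of the color vector $\mathbf c=1^m2\,1^n$ (that is, $m$ entries equal to $1$, followed by one entry $2$, followed by $n$ entries equal to $1$) is $mn$.
   Context: **Trees and associahedra.** Finite binary trees are rooted, planar; every vertex has $0$ or two (ordered: left, right) children except the root $*$, which has degree $1$ and a single child $\emptyset$ (non-root vertices are addressed by words over $\{0,1\}$, the children of $u$ being $u0$ and $u1$). Leaves are numbered left to right. The vertices of the $d$-dimensional associahedron $A_d$ are the finite binary trees with $d+2$ leaves. Two trees are joined by an edge of $A_d$ iff one is obtained from the other by a rotation: if $u$ and $u0$ are internal vertices of $T$, the rotation at $u$ replaces, at $u$, the subtree structure $((A,B),C)$ by $(A,(B,C))$, where $A,B,C$ are the subtrees at $u00,u01,u1$. **Colors.** Colors are elements of $\mathbb Z_2\times\mathbb Z_2$, coded $0=(0,0)$, $1=(0,1)$, $2=(1,0)$, $3=(1,1)$. A color vector $\mathbf c=(c_1,\dots,c_k)$ for a tree with $k$ leaves determines the unique edge coloring in which the edge at the $i$-th leaf has color $c_i$ and the three edges at each internal vertex sum to $0$. It is valid for the tree if this is a proper edge coloring using only colors $1,2,3$. **Color graph.** For a color vector $\mathbf c$ with $d+2$ entries, the color graph of $\mathbf c$ is the subgraph of the $1$-skeleton of $A_d$ spanned (induced) by the vertices (trees) for which $\mathbf c$ is valid. Its diameter is taken with respect to the graph distance. Here $d=m+n-1$. *)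

theory Defs
  imports "Graph_Theory.Graph_Theory" "HOL-Library.Z2" "HOL-Library.Product_Plus"
begin

text \<open>
  The root \<open>*\<close> of degree 1 is left implicit: a value of this type is the subtree below
  \<open>*\<close>, and its topmost vertex is the one addressed by the empty word.
\<close>

datatype bin_tree = Leaf | Node bin_tree bin_tree

text \<open>Words over \<open>{0,1}\<close> are boolean lists, with \<open>False\<close> for 0 and \<open>True\<close> for 1.\<close>

type_synonym address = "bool list"

fun nonroot_vertices :: "bin_tree \<Rightarrow> address set" where
  "nonroot_vertices Leaf = {[]}"
| "nonroot_vertices (Node l r) =
     {[]} \<union> (#) False ` nonroot_vertices l \<union> (#) True ` nonroot_vertices r"

fun internal_vertices :: "bin_tree \<Rightarrow> address set" where
  "internal_vertices Leaf = {}"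
| "internal_vertices (Node l r) =
     {[]} \<union> (#) False ` internal_vertices l \<union> (#) True ` internal_vertices r"

fun leaves :: "bin_tree \<Rightarrow> address list" where
  "leaves Leaf = [[]]"
| "leaves (Node l r) = map ((#) False) (leaves l) @ map ((#) True) (leaves r)"

text \<open>
  The rotation at a vertex \<open>u\<close>; \<open>left\<close> and \<open>right\<close> descend along the address of \<open>u\<close>.
\<close>

inductive rotation :: "bin_tree \<Rightarrow> bin_tree \<Rightarrow> bool" where
  top: "rotation (Node (Node A B) C) (Node A (Node B C))"
| left: "rotation l l' \<Longrightarrow> rotation (Node l r) (Node l' r)"
| right: "rotation r r' \<Longrightarrow> rotation (Node l r) (Node l r')"

text \<open>
  The 1-skeleton of the \<open>d\<close>-dimensional associahedron. As usual in \<open>Graph_Theory\<close>, an undirected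
  edge is a pair of opposite arcs.
\<close>

definition associahedron_skeleton :: "nat \<Rightarrow> bin_tree pair_pre_digraph" where
  "associahedron_skeleton d =
     (let V = {T. length (leaves T) = d + 2}
      in \<lparr> pverts = V,
           parcs = {(S, T). S \<in> V \<and> T \<in> V \<and> (rotation S T \<or> rotation T S)} \<rparr>)"

type_synonym color = "bit \<times> bit"

abbreviation color1 :: color where "color1 \<equiv> (0, 1)"
abbreviation color2 :: color where "color2 \<equiv> (1, 0)"
abbreviation color3 :: color where "color3 \<equiv> (1, 1)"

text \<open>
  Every edge joins a non-root vertex \<open>u\<close> to its parent, so edges are represented by their lower
  end \<open>u\<close>. The three edges at an internal vertex \<open>u\<close> are then \<open>u\<close>, \<open>u0\<close> and \<open>u1\<close>.
\<close>

definition determines_coloring :: "bin_tree \<Rightarrow> color list \<Rightarrow> (address \<Rightarrow> color) \<Rightarrow> bool" where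
  "determines_coloring T c f \<longleftrightarrow>
     map f (leaves T) = c \<and>
     (\<forall>u \<in> internal_vertices T. f u + f (u @ [False]) + f (u @ [True]) = 0)"

definition proper_coloring :: "bin_tree \<Rightarrow> (address \<Rightarrow> color) \<Rightarrow> bool" where
  "proper_coloring T f \<longleftrightarrow>
     (\<forall>u \<in> internal_vertices T. distinct [f u, f (u @ [False]), f (u @ [True])])"

text \<open>
  The coloring \<open>f\<close> below exists and is unique on the edges of \<open>T\<close> as soon as \<open>c\<close> has one entry
  per leaf; see \<open>determines_coloring_exists\<close> and \<open>determines_coloring_unique\<close>.
\<close>

definition valid_colors :: "bin_tree \<Rightarrow> color list \<Rightarrow> bool" where
  "valid_colors T c \<longleftrightarrow>
     (\<exists>f. determines_coloring T c f \<and> proper_coloring T f \<and>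
          f ` nonroot_vertices T \<subseteq> {color1, color2, color3})"

lemma determines_coloring_Node:
  "determines_coloring (Node l r) c f \<longleftrightarrow>
     (\<exists>c1 c2. c = c1 @ c2 \<and> determines_coloring l c1 (\<lambda>u. f (False # u)) \<and>
        determines_coloring r c2 (\<lambda>u. f (True # u)) \<and> f [] + f [False] + f [True] = 0)"
  by (simp add: determines_coloring_def comp_def ball_Un) metis

lemma determines_coloring_exists:
  "length c = length (leaves T) \<Longrightarrow> \<exists>f. determines_coloring T c f"
proof (induction T arbitrary: c)
  case Leaf
  then obtain x where "c = [x]" by (auto simp: length_Suc_conv)
  then show ?case by (auto simp: determines_coloring_def intro: exI[of _ "\<lambda>_. x"])
next
  case (Node l r)
  let ?c1 = "take (length (leaves l)) c" and ?c2 = "drop (length (leaves l)) c"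
  obtain f g where fg: "determines_coloring l ?c1 f" "determines_coloring r ?c2 g"
    using Node.IH(1)[of ?c1] Node.IH(2)[of ?c2] Node.prems by auto
  define h where "h u = (case u of [] \<Rightarrow> - (f [] + g []) | b # v \<Rightarrow> if b then g v else f v)" for u
  have "determines_coloring (Node l r) c h"
    unfolding determines_coloring_Node
    by (rule exI[of _ ?c1], rule exI[of _ ?c2]) (use fg in \<open>simp add: h_def\<close>)
  then show ?case by blast
qed

lemma determines_coloring_unique:
  assumes "determines_coloring T c f" "determines_coloring T c g" "u \<in> nonroot_vertices T"
  shows "f u = g u"
  using assms
proof (induction T arbitrary: c f g u)
  case Leaf
  then show ?case by (auto simp: determines_coloring_def)
next
  case (Node l r)
  from Node.prems(1) obtain c1 c2 where f: "c = c1 @ c2"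
    "determines_coloring l c1 (\<lambda>u. f (False # u))"
    "determines_coloring r c2 (\<lambda>u. f (True # u))" "f [] + (f [False] + f [True]) = 0"
    by (auto simp: determines_coloring_Node add.assoc)
  from Node.prems(2) obtain d1 d2 where g: "c = d1 @ d2"
    "determines_coloring l d1 (\<lambda>u. g (False # u))"
    "determines_coloring r d2 (\<lambda>u. g (True # u))" "g [] + (g [False] + g [True]) = 0"
    by (auto simp: determines_coloring_Node add.assoc)
  have "length c1 = length d1"
    using f(2) g(2) by (auto simp: determines_coloring_def)
  with f(1) g(1) have d: "d1 = c1" "d2 = c2" by auto
  have L: "f (False # v) = g (False # v)" if "v \<in> nonroot_vertices l" for v
    using Node.IH(1)[OF f(2) g(2)[unfolded d] that] by simp
  have R: "f (True # v) = g (True # v)" if "v \<in> nonroot_vertices r" for v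
    using Node.IH(2)[OF f(3) g(3)[unfolded d] that] by simp
  have top: "[] \<in> nonroot_vertices t" for t by (cases t) auto
  have "f [] = g []"
    using f(4) g(4) L[OF top] R[OF top] by (metis add_right_cancel)
  with Node.prems(3) L R show ?case by auto
qed

definition color_graph :: "color list \<Rightarrow> (bin_tree, bin_tree \<times> bin_tree) pre_digraph" where
  "color_graph c =
     (let G = with_proj (associahedron_skeleton (length c - 2))
      in G \<restriction> {T \<in> verts G. valid_colors T c})"

text \<open>
  The distance \<open>wf_digraph.\<mu>\<close> with unit weights is the graph distance, being \<open>\<infinity>\<close> between
  vertices that no walk connects. Hence a finite diameter includes connectedness, and a
  diameter other than \<open>-\<infinity>\<close> includes that the graph has a vertex.
\<close>

definition graph_diameter :: "('a, 'b) pre_digraph \<Rightarrow> ereal" where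
  "graph_diameter G = (SUP (u, v) \<in> verts G \<times> verts G. wf_digraph.\<mu> G (\<lambda>_. 1) u v)"

text \<open>The defining equation of \<open>wf_digraph.\<mu>\<close> is available only for well-formed digraphs.\<close>

lemma wf_digraph_color_graph: "wf_digraph (color_graph c)"
proof -
  interpret pair_wf_digraph "associahedron_skeleton (length c - 2)"
    by unfold_locales (auto simp: associahedron_skeleton_def Let_def)
  show ?thesis
    unfolding color_graph_def Let_def
    by (intro wellformed_induce_subgraph)
qed

end

theory Submission
  imports Defs
begin

text \<open>
  A tree whose leaves all have color 1 is proper only if it is a single leaf, because the
  parent of two leaves of color 1 violates properness. So in a tree for which \<open>1\<^sup>m 2 1\<^sup>n\<close> is
  valid, every vertex on the way from the top to the leaf of color 2 has a leaf as its other
  child: the tree is a caterpillar, and it is recorded by the word that says, from the top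
  downwards, on which side these leaves hang. Exactly \<open>m\<close> letters are \<open>L\<close> and \<open>n\<close> are \<open>R\<close>.
  Conversely all such words give valid trees, the colors 2 and 3 alternating along the spine
  (\<open>valid_colors_iff\<close>).

  A rotation replaces \<open>((A,B),C)\<close> by \<open>(A,(B,C))\<close>. Between two caterpillars this is possible only
  if the leaf of color 2 lies in \<open>B\<close> and \<open>A\<close> and \<open>C\<close> are leaves, so rotations are exactly the exchanges of adjacent letters
  \<open>RL\<close> and \<open>LR\<close> (\<open>rotation_caterpillar_iff\<close>). The color graph is thus the graph of adjacent
  transpositions on words with \<open>m\<close> letters \<open>L\<close> and \<open>n\<close> letters \<open>R\<close>.

  An exchange changes the number of inversions by one, and \<open>R\<^sup>n L\<^sup>m\<close> has \<open>mn\<close> inversions while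
  \<open>L\<^sup>m R\<^sup>n\<close> has none; this bounds the diameter from below. For the upper bound, let \<open>a\<close> be the
  first letter of the target. The first \<open>a\<close> of the source moves to the front past letters of
  the other kind only, at most \<open>n\<close> of them if \<open>a = L\<close>, and at most \<open>(m - 1) n\<close> exchanges
  settle the rest by induction; the case \<open>a = R\<close> is symmetric (\<open>transpositions_connect\<close>).
\<close>

section \<open>Caterpillars and their leaf colors\<close>

datatype side = L | R

text \<open>
  The last letter has no effect on the tree: both one-letter words give the cherry. Together
  with the number of letters \<open>L\<close> the tree does determine the word
  (\<open>caterpillar_inj\<close>).
\<close>

fun caterpillar :: "side list \<Rightarrow> bin_tree" where
  "caterpillar [] = Leaf"
| "caterpillar (L # w) = Node Leaf (caterpillar w)"
| "caterpillar (R # w) = Node (caterpillar w) Leaf"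

definition words :: "nat \<Rightarrow> nat \<Rightarrow> side list set" where
  "words m n = {w. count_list w L = m \<and> count_list w R = n}"

abbreviation ones_two_ones :: "nat \<Rightarrow> nat \<Rightarrow> color list" where
  "ones_two_ones m n \<equiv> replicate m color1 @ color2 # replicate n color1"

lemma count_side: "count_list w L + count_list w R = length w"
  by (induction w rule: caterpillar.induct) auto

lemma caterpillar_eq_Leaf [simp]:
  "caterpillar w = Leaf \<longleftrightarrow> w = []" "Leaf = caterpillar w \<longleftrightarrow> w = []"
  by (cases w rule: caterpillar.cases; auto)+

lemma caterpillar_inj:
  assumes "caterpillar v = caterpillar w" "count_list v L = count_list w L"
  shows "v = w"
  using assms
proof (induction v arbitrary: w rule: caterpillar.induct)
  case 1
  then show ?case by simp
next
  case (2 v)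
  then show ?case by (cases w rule: caterpillar.cases) auto
next
  case (3 v)
  then show ?case by (cases w rule: caterpillar.cases) auto
qed

lemma length_leaves_caterpillar: "length (leaves (caterpillar w)) = Suc (length w)"
  by (induction w rule: caterpillar.induct) auto

text \<open>
  Properness at a vertex depends on the colors of the edges above its two subtrees, so an
  induction on the tree has to keep track of the color of the edge above the topmost vertex.
\<close>

definition top_color :: "bin_tree \<Rightarrow> color list \<Rightarrow> color \<Rightarrow> bool" where
  "top_color T c x \<longleftrightarrow>
     (\<exists>f. determines_coloring T c f \<and> proper_coloring T f \<and>
          f ` nonroot_vertices T \<subseteq> {color1, color2, color3} \<and> f [] = x)"

lemma top_color_Leaf: "top_color Leaf c x \<longleftrightarrow> c = [x] \<and> x \<in> {color1, color2, color3}"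
  by (auto simp: top_color_def determines_coloring_def proper_coloring_def
      intro: exI[of _ "\<lambda>_. x"])

lemma proper_coloring_Node:
  "proper_coloring (Node l r) f \<longleftrightarrow>
     proper_coloring l (\<lambda>u. f (False # u)) \<and> proper_coloring r (\<lambda>u. f (True # u)) \<and>
     distinct [f [], f [False], f [True]]"
  by (auto simp: proper_coloring_def ball_Un)

lemma top_color_Node:
  "top_color (Node l r) c x \<longleftrightarrow>
     (\<exists>c1 c2 y z. c = c1 @ c2 \<and> top_color l c1 y \<and> top_color r c2 z \<and>
        x + y + z = 0 \<and> distinct [x, y, z] \<and> x \<in> {color1, color2, color3})"
    (is "_ \<longleftrightarrow> ?split")
proof
  assume "top_color (Node l r) c x"
  then obtain f where f: "determines_coloring (Node l r) c f" "proper_coloring (Node l r) f"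
    "f ` nonroot_vertices (Node l r) \<subseteq> {color1, color2, color3}" "f [] = x"
    unfolding top_color_def by blast
  obtain c1 c2 where c: "c = c1 @ c2" "determines_coloring l c1 (\<lambda>u. f (False # u))"
    "determines_coloring r c2 (\<lambda>u. f (True # u))" "f [] + f [False] + f [True] = 0"
    using f(1) unfolding determines_coloring_Node by blast
  have im: "(\<lambda>u. f (False # u)) ` nonroot_vertices l \<subseteq> {color1, color2, color3}"
    "(\<lambda>u. f (True # u)) ` nonroot_vertices r \<subseteq> {color1, color2, color3}"
    "x \<in> {color1, color2, color3}"
    using f(3,4) by (simp_all only: nonroot_vertices.simps image_Un image_image) blast+
  have "top_color l c1 (f [False])" "top_color r c2 (f [True])"
    using f(2) c(2,3) im(1,2) unfolding top_color_def proper_coloring_Node by blast+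
  moreover have "distinct [x, f [False], f [True]]" "x + f [False] + f [True] = 0"
    using f(2,4) c(4) by (simp_all only: proper_coloring_Node)
  ultimately show ?split
    using c(1) im(3) by blast
next
  assume ?split
  then obtain c1 c2 f g where *: "c = c1 @ c2"
    "determines_coloring l c1 f" "proper_coloring l f"
    "f ` nonroot_vertices l \<subseteq> {color1, color2, color3}"
    "determines_coloring r c2 g" "proper_coloring r g"
    "g ` nonroot_vertices r \<subseteq> {color1, color2, color3}"
    "x + f [] + g [] = 0" "distinct [x, f [], g []]" "x \<in> {color1, color2, color3}"
    unfolding top_color_def by blast
  define h where "h u = (case u of [] \<Rightarrow> x | b # v \<Rightarrow> if b then g v else f v)" for u
  have "determines_coloring (Node l r) c h"
    unfolding determines_coloring_Node
    by (rule exI[of _ c1], rule exI[of _ c2]) (use * in \<open>simp add: h_def\<close>)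
  moreover have "proper_coloring (Node l r) h"
    using *(3,6,9) by (simp only: proper_coloring_Node h_def list.case if_True if_False)
  moreover have "h ` nonroot_vertices (Node l r) \<subseteq> {color1, color2, color3}"
    using *(4,7,10)
    by (simp only: nonroot_vertices.simps image_Un image_image image_insert image_empty h_def
        list.case if_True if_False Un_subset_iff insert_subset empty_subsetI simp_thms)
  moreover have "h [] = x"
    by (simp add: h_def)
  ultimately show "top_color (Node l r) c x"
    unfolding top_color_def by blast
qed

text \<open>
  By induction, the two subtrees of a larger tree would be leaves of color 1, and these may not
  meet at its top.
\<close>

lemma top_color_ones:
  "top_color T (replicate k color1) x \<Longrightarrow> T = Leaf \<and> k = 1 \<and> x = color1"
proof (induction T arbitrary: k x)
  case Leaf
  then show ?case by (cases k) (auto simp: top_color_Leaf)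
next
  case (Node l r)
  then obtain c1 c2 y z where *: "replicate k color1 = c1 @ c2"
    "top_color l c1 y" "top_color r c2 z" "y \<noteq> z"
    unfolding top_color_Node distinct.simps by (metis list.set_intros(1))
  then have "c1 = replicate (length c1) color1" "c2 = replicate (length c2) color1"
    by (metis append_eq_conv_conj length_replicate take_replicate drop_replicate)+
  with * Node.IH show ?case by metis
qed

lemma append_eq_ones_two_ones:
  assumes "c1 @ c2 = ones_two_ones m n"
  obtains (left) j where "j \<le> n" "c1 = ones_two_ones m (n - j)" "c2 = replicate j color1"
  | (right) i where "i \<le> m" "c1 = replicate i color1" "c2 = ones_two_ones (m - i) n"
proof (cases "length c1 \<le> m")
  case True
  have "c1 = take (length c1) (ones_two_ones m n)" "c2 = drop (length c1) (ones_two_ones m n)"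
    using assms by (metis append_eq_conv_conj)+
  with True right show ?thesis by simp
next
  case False
  define k where "k = length c1 - Suc m"
  with False have k: "length c1 = Suc (m + k)" by simp
  have "length c1 \<le> Suc (m + n)"
    using arg_cong[OF assms, of length] by simp
  with k have "k \<le> n" by simp
  have "c1 = take (length c1) (ones_two_ones m n)" "c2 = drop (length c1) (ones_two_ones m n)"
    using assms by (metis append_eq_conv_conj)+
  then have "c1 = ones_two_ones m (n - (n - k))" "c2 = replicate (n - k) color1"
    using k \<open>k \<le> n\<close> by (simp_all add: min_def)
  then show ?thesis using left[of "n - k"] by simp
qed

lemma top_color_caterpillar:
  "\<exists>x \<in> {color2, color3}.
     top_color (caterpillar w) (ones_two_ones (count_list w L) (count_list w R)) x"
proof (induction w rule: caterpillar.induct)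
  case 1
  then show ?case by (auto simp: top_color_Leaf)
next
  case (2 w)
  then obtain x where x: "x \<in> {color2, color3}"
    "top_color (caterpillar w) (ones_two_ones (count_list w L) (count_list w R)) x" ..
  have "top_color (caterpillar (L # w))
      (ones_two_ones (count_list (L # w) L) (count_list (L # w) R)) (color1 + x)"
    unfolding caterpillar.simps top_color_Node
    by (rule exI[of _ "[color1]"], rule exI, rule exI[of _ color1], rule exI[of _ x])
      (use x in \<open>auto simp: top_color_Leaf zero_prod_def\<close>)
  then show ?case using x by (intro bexI[of _ "color1 + x"]) auto
next
  case (3 w)
  then obtain x where x: "x \<in> {color2, color3}"
    "top_color (caterpillar w) (ones_two_ones (count_list w L) (count_list w R)) x" ..
  have "top_color (caterpillar (R # w))
      (ones_two_ones (count_list (R # w) L) (count_list (R # w) R)) (x + color1)"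
    unfolding caterpillar.simps top_color_Node
    by (rule exI, rule exI[of _ "[color1]"], rule exI[of _ x], rule exI[of _ color1])
      (use x in \<open>auto simp: top_color_Leaf zero_prod_def replicate_append_same\<close>)
  then show ?case using x by (intro bexI[of _ "x + color1"]) auto
qed

lemma top_color_imp_caterpillar:
  "top_color T (ones_two_ones m n) x \<Longrightarrow> \<exists>w \<in> words m n. T = caterpillar w"
proof (induction T arbitrary: m n x)
  case Leaf
  then have "length (ones_two_ones m n) = 1" by (simp add: top_color_Leaf)
  then show ?case by (intro bexI[of _ "[]"]) (auto simp: words_def)
next
  case (Node l r)
  then obtain c1 c2 y z where c: "c1 @ c2 = ones_two_ones m n"
    and l: "top_color l c1 y" and r: "top_color r c2 z"
    unfolding top_color_Node by metis
  from c show ?case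
  proof (cases rule: append_eq_ones_two_ones)
    case (left j)
    with r have "r = Leaf" "j = 1" using top_color_ones by blast+
    moreover obtain w where "w \<in> words m (n - j)" "l = caterpillar w"
      using Node.IH(1) l left by blast
    ultimately show ?thesis
      using left by (intro bexI[of _ "R # w"]) (auto simp: words_def)
  next
    case (right i)
    with l have "l = Leaf" "i = 1" using top_color_ones by blast+
    moreover obtain w where "w \<in> words (m - i) n" "r = caterpillar w"
      using Node.IH(2) r right by blast
    ultimately show ?thesis
      using right by (intro bexI[of _ "L # w"]) (auto simp: words_def)
  qed
qed

lemma valid_colors_iff:
  "valid_colors T (ones_two_ones m n) \<longleftrightarrow> T \<in> caterpillar ` words m n"
proof -
  have "valid_colors T c \<longleftrightarrow> (\<exists>x. top_color T c x)" for c
    unfolding valid_colors_def top_color_def by blast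
  then show ?thesis
    using top_color_imp_caterpillar top_color_caterpillar by (fastforce simp: words_def)
qed

section \<open>Rotations as adjacent transpositions\<close>

inductive transposition :: "side list \<Rightarrow> side list \<Rightarrow> bool" where
  here: "transposition (R # L # w) (L # R # w)"
| there: "transposition v w \<Longrightarrow> transposition (a # v) (a # w)"

lemma transposition_count: "transposition v w \<Longrightarrow> count_list v a = count_list w a"
  by (induction rule: transposition.induct) auto

lemma transposition_imp_rotation:
  "transposition v w \<Longrightarrow> rotation (caterpillar v) (caterpillar w)"
proof (induction rule: transposition.induct)
  case (here w)
  then show ?case by (simp add: rotation.top)
next
  case (there v w a)
  then show ?case by (cases a) (auto intro: rotation.left rotation.right)
qed

text \<open>
  Equal numbers of \<open>L\<close> are needed because of the ambiguous last letter: the caterpillars of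
  \<open>RR\<close> and \<open>LL\<close> are related by a rotation.
\<close>

lemma rotation_imp_transposition:
  assumes "rotation (caterpillar v) (caterpillar w)"
    and "count_list v L = count_list w L" and "length v = length w"
  shows "transposition v w"
  using assms
proof (induction v arbitrary: w)
  case Nil
  then show ?case by (auto elim: rotation.cases)
next
  case (Cons a v)
  from Cons.prems(3) obtain b w' where w: "w = b # w'" by (cases w) auto
  have no_Leaf: "\<not> rotation Leaf T" "\<not> rotation T Leaf" for T
    by (auto elim: rotation.cases)
  from Cons.prems(1) show ?case
  proof cases
    case (top A B C)
    then have a: "a = R" "caterpillar v = Node A B" "C = Leaf"
      by (cases a; simp)+
    have b: "b = L" "caterpillar w' = Node B C" "A = Leaf"
      using top w by (cases b; simp)+
    show ?thesis
    proof (cases "B = Leaf")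
      case True
      \<comment> \<open>Both inner trees are cherries, so only the letter count fixes the last letters.\<close>
      with a b have "length (leaves (caterpillar v)) = 2" "length (leaves (caterpillar w')) = 2"
        by auto
      then have "length v = 1" "length w' = 1"
        by (simp_all add: length_leaves_caterpillar)
      then obtain x y where "v = [x]" "w' = [y]"
        by (auto simp: length_Suc_conv)
      then show ?thesis
        using Cons.prems(2) w a b
        by (cases x; cases y) (auto intro: transposition.here)
    next
      case False
      obtain v' where v: "v = L # v'" "caterpillar v' = B"
        using a b False by (cases v rule: caterpillar.cases) auto
      moreover obtain w'' where w'': "w' = R # w''" "caterpillar w'' = B"
        using a b False by (cases w' rule: caterpillar.cases) auto
      moreover have "v' = w''"
        using caterpillar_inj[of v' w''] Cons.prems(2) w a b v w'' by simp
      ultimately show ?thesis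
        using w a b by (simp add: transposition.here)
    qed
  next
    case (left l l' r)
    then have "a = R" "l = caterpillar v"
      using no_Leaf by (cases a; auto)+
    moreover have "b = R" "l' = caterpillar w'"
      using left w no_Leaf by (cases b; auto)+
    ultimately show ?thesis
      using Cons.IH[of w'] Cons.prems w left by (auto intro: transposition.there)
  next
    case (right r r' l)
    then have "a = L" "r = caterpillar v"
      using no_Leaf by (cases a; auto)+
    moreover have "b = L" "r' = caterpillar w'"
      using right w no_Leaf by (cases b; auto)+
    ultimately show ?thesis
      using Cons.IH[of w'] Cons.prems w right by (auto intro: transposition.there)
  qed
qed

lemma rotation_caterpillar_iff:
  assumes "v \<in> words m n" "w \<in> words m n"
  shows "rotation (caterpillar v) (caterpillar w) \<longleftrightarrow> transposition v w"
  using assms count_side[of v] count_side[of w]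
  by (auto simp: words_def intro: transposition_imp_rotation rotation_imp_transposition)

section \<open>Distances between words\<close>

lemma symclp_transposition_count:
  "symclp transposition v w \<Longrightarrow> count_list v a = count_list w a"
  by (auto simp: symclp_def transposition_count)

lemma transpositions_count:
  "(symclp transposition ^^ k) v w \<Longrightarrow> count_list v a = count_list w a"
proof (induction k arbitrary: w)
  case (Suc k)
  then show ?case by (auto dest: symclp_transposition_count)
qed simp

lemma transpositions_Cons:
  "(symclp transposition ^^ k) v w \<Longrightarrow> (symclp transposition ^^ k) (a # v) (a # w)"
proof (induction k arbitrary: w)
  case (Suc k)
  then obtain u where "(symclp transposition ^^ k) v u" "symclp transposition u w" by auto
  moreover from this have "symclp transposition (a # u) (a # w)"
    by (auto simp: symclp_def intro: transposition.there)
  ultimately show ?case using Suc.IH by auto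
qed simp

text \<open>The leftmost \<open>a\<close> has only letters different from \<open>a\<close> to pass.\<close>

lemma move_to_front:
  assumes "a \<in> set w"
  shows "\<exists>u. \<exists>k \<le> length w - count_list w a. (symclp transposition ^^ k) w (a # u)"
  using assms
proof (induction w)
  case (Cons b w)
  show ?case
  proof (cases "b = a")
    case True
    then show ?thesis by (intro exI[of _ w] exI[of _ 0]) auto
  next
    case False
    with Cons obtain u k where k: "k \<le> length w - count_list w a"
      and "(symclp transposition ^^ k) w (a # u)" by auto
    then have "(symclp transposition ^^ k) (b # w) (b # a # u)"
      by (intro transpositions_Cons)
    moreover have "symclp transposition (b # a # u) (a # b # u)"
      using False by (cases a; cases b) (auto simp: symclp_def intro: transposition.here)
    ultimately have "(symclp transposition ^^ Suc k) (b # w) (a # b # u)" by auto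
    moreover have "Suc k \<le> length (b # w) - count_list (b # w) a"
      using k False count_le_length[of w a] by simp
    ultimately show ?thesis by blast
  qed
qed simp

lemma transpositions_connect:
  assumes "v \<in> words m n" "w \<in> words m n"
  shows "\<exists>k \<le> m * n. (symclp transposition ^^ k) v w"
  using assms
proof (induction w arbitrary: v m n)
  case Nil
  then have "v = []" using count_side[of v] by (simp add: words_def)
  then show ?case by (intro exI[of _ 0]) auto
next
  case (Cons a w)
  have count: "count_list v b = count_list (a # w) b" for b
    using Cons.prems by (cases b) (auto simp: words_def)
  then have "a \<in> set v"
    using count_list_0_iff[of v a] by auto
  then obtain u k where k: "k \<le> length v - count_list v a"
    and vu: "(symclp transposition ^^ k) v (a # u)"
    using move_to_front by blast
  have "count_list u b = count_list w b" for b
    using transpositions_count[OF vu, of b] count[of b] by (auto split: if_splits)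
  then obtain j where j: "j \<le> count_list w L * count_list w R"
    and uw: "(symclp transposition ^^ j) u w"
    using Cons.IH[of u "count_list w L" "count_list w R"] by (auto simp: words_def)
  have "(symclp transposition ^^ (k + j)) v (a # w)"
    using vu transpositions_Cons[OF uw] by (auto simp: relpowp_add)
  moreover have "k + j \<le> m * n"
  proof -
    have "m = count_list (a # w) L" "n = count_list (a # w) R" "length v = m + n"
      using Cons.prems count_side[of v] by (auto simp: words_def)
    with j k count[of a] show ?thesis
      by (cases a) auto
  qed
  ultimately show ?case by blast
qed

fun inversions :: "side list \<Rightarrow> nat" where
  "inversions [] = 0"
| "inversions (L # w) = inversions w"
| "inversions (R # w) = count_list w L + inversions w"

lemma inversions_transposition: "transposition v w \<Longrightarrow> inversions v = Suc (inversions w)"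
proof (induction rule: transposition.induct)
  case (there v w a)
  then show ?case by (cases a) (auto simp: transposition_count)
qed simp

lemma inversions_extremal:
  "inversions (replicate m L @ replicate n R) = 0"
  "inversions (replicate n R @ replicate m L) = m * n"
proof -
  have "inversions (replicate n R) = 0" by (induction n) auto
  then show "inversions (replicate m L @ replicate n R) = 0" by (induction m) auto
  have "inversions (replicate m L) = 0" by (induction m) auto
  moreover have "count_list (replicate m L) L = m" by (induction m) auto
  ultimately show "inversions (replicate n R @ replicate m L) = m * n"
    by (induction n) auto
qed

section \<open>The color graph\<close>

text \<open>
  The skeleton asks for \<open>(m + n + 1) - 2 + 2\<close> leaves; as the subtraction is truncated, this is
  the length of the color vector only if \<open>m + n \<ge> 1\<close>.
\<close>

lemma verts_color_graph:
  assumes "m + n \<ge> 1"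
  shows "verts (color_graph (ones_two_ones m n)) = caterpillar ` words m n"
  using assms count_side
  by (auto simp: color_graph_def associahedron_skeleton_def Let_def valid_colors_iff
      length_leaves_caterpillar words_def)

lemma arcs_color_graph:
  assumes "m + n \<ge> 1" "v \<in> words m n" "w \<in> words m n"
  shows "(caterpillar v, caterpillar w) \<in> arcs (color_graph (ones_two_ones m n)) \<longleftrightarrow>
         symclp transposition v w"
proof -
  let ?G = "color_graph (ones_two_ones m n)"
  have "caterpillar v \<in> verts ?G" "caterpillar w \<in> verts ?G"
    using assms by (simp_all add: verts_color_graph)
  then have "(caterpillar v, caterpillar w) \<in> arcs ?G \<longleftrightarrow>
      rotation (caterpillar v) (caterpillar w) \<or> rotation (caterpillar w) (caterpillar v)"
    by (auto simp: color_graph_def associahedron_skeleton_def Let_def)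
  then show ?thesis
    using assms rotation_caterpillar_iff by (auto simp: symclp_def)
qed

lemma ends_color_graph [simp]: "tail (color_graph c) = fst" "head (color_graph c) = snd"
  by (simp_all add: color_graph_def Let_def)

lemma awalk_of_transpositions:
  assumes "m + n \<ge> 1" "v \<in> words m n" "(symclp transposition ^^ k) v w"
  shows "\<exists>p. pre_digraph.awalk (color_graph (ones_two_ones m n)) (caterpillar v) p (caterpillar w)
             \<and> length p = k"
proof -
  interpret wf_digraph "color_graph (ones_two_ones m n)" by (rule wf_digraph_color_graph)
  show ?thesis
    using assms(2,3)
  proof (induction k arbitrary: v)
    case 0
    then show ?case using assms(1) by (auto simp: awalk_Nil_iff verts_color_graph)
  next
    case (Suc k)
    from Suc.prems(2) obtain u where u: "symclp transposition v u" "(symclp transposition ^^ k) u w"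
      using relpowp_Suc_D2 by metis
    have "u \<in> words m n"
      using u(1) Suc.prems(1) by (simp add: words_def symclp_transposition_count)
    moreover from this obtain p where "awalk (caterpillar u) p (caterpillar w)" "length p = k"
      using Suc.IH u(2) by blast
    ultimately show ?case
      using u(1) Suc.prems(1) assms(1) arcs_color_graph[of m n v u]
      by (intro exI[of _ "(caterpillar v, caterpillar u) # p"]) (auto simp: awalk_Cons_iff)
  qed
qed

lemma inversions_awalk:
  assumes "m + n \<ge> 1" "v \<in> words m n" "w \<in> words m n"
    and "pre_digraph.awalk (color_graph (ones_two_ones m n)) (caterpillar v) p (caterpillar w)"
  shows "inversions v \<le> length p + inversions w"
proof -
  interpret wf_digraph "color_graph (ones_two_ones m n)" by (rule wf_digraph_color_graph)
  show ?thesis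
    using assms(2,4)
  proof (induction p arbitrary: v)
    case Nil
    then have "v = w"
      using assms(3) by (intro caterpillar_inj) (auto simp: awalk_Nil_iff words_def)
    then show ?case by simp
  next
    case (Cons e p)
    then have e: "e \<in> arcs (color_graph (ones_two_ones m n))" "fst e = caterpillar v"
      and p: "awalk (snd e) p (caterpillar w)"
      by (auto simp: awalk_Cons_iff)
    have "snd e \<in> verts (color_graph (ones_two_ones m n))"
      using p by (auto dest: awalk_hd_in_verts)
    then obtain u where u: "u \<in> words m n" "snd e = caterpillar u"
      using assms(1) by (auto simp: verts_color_graph)
    have "symclp transposition v u"
      using arcs_color_graph[of m n v u] assms(1) Cons.prems(1) u e by (metis prod.collapse)
    then have "inversions v \<le> Suc (inversions u)"
      by (auto simp: symclp_def dest: inversions_transposition)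
    with Cons.IH[of u] u p show ?case by simp
  qed
qed

theorem proposition10p2:
  fixes m n :: nat
  assumes "m + n \<ge> 1"
  shows "graph_diameter (color_graph (replicate m color1 @ [color2] @ replicate n color1))
         = ereal (real (m * n))"
proof -
  interpret wf_digraph "color_graph (ones_two_ones m n)" by (rule wf_digraph_color_graph)
  let ?V = "verts (color_graph (ones_two_ones m n))"
  have cost: "awalk_cost (\<lambda>_. 1) p = real (length p)" for p :: "(bin_tree \<times> bin_tree) list"
    by (induction p) auto
  have upper: "\<mu> (\<lambda>_. 1) S T \<le> ereal (real (m * n))" if "S \<in> ?V" "T \<in> ?V" for S T
  proof -
    from that obtain v w where vw: "v \<in> words m n" "S = caterpillar v"
      "w \<in> words m n" "T = caterpillar w"
      using assms by (auto simp: verts_color_graph)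
    then obtain k where k: "k \<le> m * n" "(symclp transposition ^^ k) v w"
      using transpositions_connect by blast
    then obtain p where "awalk S p T" "length p = k"
      using awalk_of_transpositions assms vw by blast
    then have "\<mu> (\<lambda>_. 1) S T \<le> ereal (real k)"
      using min_cost_le_walk_cost cost by metis
    also have "\<dots> \<le> ereal (real (m * n))"
      using k(1) by (simp only: ereal_less_eq of_nat_le_iff)
    finally show ?thesis .
  qed
  define v w where "v = replicate n R @ replicate m L" and "w = replicate m L @ replicate n R"
  have "count_list (replicate k a) b = (if a = b then k else 0)" for k and a b :: side
    by (induction k) auto
  then have vw: "v \<in> words m n" "w \<in> words m n"
    by (simp_all add: v_def w_def words_def)
  have lower: "ereal (real (m * n)) \<le> \<mu> (\<lambda>_. 1) (caterpillar v) (caterpillar w)"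
    unfolding \<mu>_def
  proof (rule INF_greatest, clarsimp simp only: mem_Collect_eq cost ereal_less_eq of_nat_le_iff)
    fix p assume "awalk (caterpillar v) p (caterpillar w)"
    then show "m * n \<le> length p"
      using inversions_awalk[OF assms vw] by (simp add: v_def w_def inversions_extremal)
  qed
  show ?thesis
    unfolding graph_diameter_def append_Cons append_Nil
  proof (rule antisym)
    show "(SUP (S, T) \<in> ?V \<times> ?V. \<mu> (\<lambda>_. 1) S T) \<le> ereal (real (m * n))"
      using upper by (auto intro!: SUP_least)
    show "ereal (real (m * n)) \<le> (SUP (S, T) \<in> ?V \<times> ?V. \<mu> (\<lambda>_. 1) S T)"
      using lower vw assms
      by (intro SUP_upper2[of "(caterpillar v, caterpillar w)"]) (auto simp: verts_color_graph)
  qed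
qed

end
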